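(* Let $T$ be the CQP monoid of $F$-colored binary trees (where $F$ is the free monoid on symbols $\pi_1,\pi_2$), let $\sim_{cp}$ be the smallest congruence on $T$ such that $\Sigma(\pi_1,\pi_2)\sim_{cp}1$, and let $U=T/\!\sim_{cp}$ with the induced operations and distinguished elements. Then $(U,\Sigma,\pi_1,\pi_2)$ is a CP monoid and is the initial object in the category of CP monoids (for every CP monoid $N$ there is exactly one CP monoid homomorphism $U\to N$). Moreover, if $N$ is a non-zero CP monoid, then the unique CP monoid homomorphism $\phi:U\to N$ is injective.
   Context: Monoids are written multiplicatively with identity $1$; a monoid is non-zero if it has more than one element. A CQP (categorical quasiproduct) monoid $(M,\Sigma,\pi_1,\pi_2)$ is a monoid $M$ with elements $\pi_1,\pi_2\in M$ and a function $\Sigma:M^2\to M$ such that for all $a,b,c\in M$: $\pi_1\Sigma(a,b)=a$, $\pi_2\Sigma(a,b)=b$, and $\Sigma(ac,bc)=\Sigma(a,b)c$. A CP (categorical product) monoid $(M,\Sigma,\pi_1,\pi_2)$ is a monoid $M$ with elements $\pi_1,\pi_2\in M$ and a bijective function $\Sigma:M^2\to M$ such that $\pi_1\Sigma(a,b)=a$ and $\pi_2\Sigma(a,b)=b$ for all $a,b\in M$. (Every CP monoid is a CQP monoid.) A CQP monoid homomorphism $(M,\Sigma,\pi_1,\pi_2)\to(N,\Phi,\tau_1,\tau_2)$ is a monoid homomorphism $f$ with $f(\pi_i)=\tau_i$ for $i=1,2$ and $f(\Sigma(a,b))=\Phi(f(a),f(b))$ for all $a,b$. A CP monoid homomorphism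 is a CQP monoid homomorphism between CP monoids. The CQP monoid $T$: Let $F$ be the free monoid on symbols $\pi_1,\pi_2$. $T$ is the set of finite nonempty ordered binary trees (each non-leaf vertex has exactly one left child and one right child) whose leaves are colored by elements of $F$; equivalently, $T$ is the free magma with basis $F$. $\Sigma(A,B)$ is the tree whose root has left subtree $A$ and right subtree $B$. Elements of $F$ are identified with the one-vertex trees, and each $A\in T$ is either in $F$ or uniquely $A=\Sigma(A_1,A_2)$. $F$ acts on $T$ from the left: $\pi_i$ sends $w\in F$ to the word $\pi_iw$, and sends $\Sigma(A_1,A_2)$ to $A_i$; a word acts by applying its symbols one at a time from right to left. The product $AB$ of $A,B\in T$ is the tree obtained from $A$ by replacing each leaf of color $w\in F$ by $wB$. With this product, identity $1\in F$, $\Sigma$, and $\pi_1,\pi_2\in F$, $T$ is a CQP monoid. A congruence on a CQP monoid is an equivalence relation $\sim$ such that $a\sim b$ and $c\sim d$ imply $ac\sim bd$ and $\Sigma(a,c)\sim\Sigma(b,d)$; the set of equivalence classes then inherits a CQP monoid structure. *)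

theory Defs
  imports "HOL-Algebra.Group" "HOL-Library.FuncSet"
begin

record 'a cqp_monoid = "'a monoid" +
  pairing :: "'a \<Rightarrow> 'a \<Rightarrow> 'a"
  proj1 :: 'a
  proj2 :: 'a

locale cqp_monoid = monoid M for M (structure) +
  assumes pairing_closed [simp, intro]:
      "\<lbrakk>a \<in> carrier M; b \<in> carrier M\<rbrakk> \<Longrightarrow> pairing M a b \<in> carrier M"
    and proj1_closed [simp, intro]: "proj1 M \<in> carrier M"
    and proj2_closed [simp, intro]: "proj2 M \<in> carrier M"
    and proj1_pairing:
      "\<lbrakk>a \<in> carrier M; b \<in> carrier M\<rbrakk> \<Longrightarrow> proj1 M \<otimes> pairing M a b = a"
    and proj2_pairing:
      "\<lbrakk>a \<in> carrier M; b \<in> carrier M\<rbrakk> \<Longrightarrow> proj2 M \<otimes> pairing M a b = b"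
    and pairing_mult:
      "\<lbrakk>a \<in> carrier M; b \<in> carrier M; c \<in> carrier M\<rbrakk>
        \<Longrightarrow> pairing M (a \<otimes> c) (b \<otimes> c) = pairing M a b \<otimes> c"

locale cp_monoid = monoid M for M (structure) +
  assumes proj1_closed [simp, intro]: "proj1 M \<in> carrier M"
    and proj2_closed [simp, intro]: "proj2 M \<in> carrier M"
    and pairing_bij:
      "bij_betw (\<lambda>(a, b). pairing M a b) (carrier M \<times> carrier M) (carrier M)"
    and proj1_pairing:
      "\<lbrakk>a \<in> carrier M; b \<in> carrier M\<rbrakk> \<Longrightarrow> proj1 M \<otimes> pairing M a b = a"
    and proj2_pairing:
      "\<lbrakk>a \<in> carrier M; b \<in> carrier M\<rbrakk> \<Longrightarrow> proj2 M \<otimes> pairing M a b = b"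

definition nonzero_monoid :: "('a, 'm) monoid_scheme \<Rightarrow> bool"
  where "nonzero_monoid M \<longleftrightarrow> (\<exists>x\<in>carrier M. \<exists>y\<in>carrier M. x \<noteq> y)"

text \<open>As for \<^const>\<open>hom\<close>, values outside the carrier are unconstrained.\<close>

definition cqp_hom ::
    "('a, 'm) cqp_monoid_scheme \<Rightarrow> ('b, 'n) cqp_monoid_scheme \<Rightarrow> ('a \<Rightarrow> 'b) set"
  where "cqp_hom M N =
    {f \<in> hom M N. f \<one>\<^bsub>M\<^esub> = \<one>\<^bsub>N\<^esub> \<and> f (proj1 M) = proj1 N \<and> f (proj2 M) = proj2 N \<and>
      (\<forall>a\<in>carrier M. \<forall>b\<in>carrier M. f (pairing M a b) = pairing N (f a) (f b))}"

definition cqp_congruence :: "('a, 'm) cqp_monoid_scheme \<Rightarrow> ('a \<times> 'a) set \<Rightarrow> bool"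
  where "cqp_congruence M r \<longleftrightarrow> equiv (carrier M) r \<and>
    (\<forall>a b c d. (a, b) \<in> r \<longrightarrow> (c, d) \<in> r \<longrightarrow>
      (a \<otimes>\<^bsub>M\<^esub> c, b \<otimes>\<^bsub>M\<^esub> d) \<in> r \<and> (pairing M a c, pairing M b d) \<in> r)"

text \<open>The unions below collapse to the class of \<open>x \<otimes> y\<close> (respectively of the pairing of
  \<open>x\<close> and \<open>y\<close>) for arbitrary representatives when \<open>r\<close> is a congruence.\<close>

definition cqp_quotient ::
    "('a, 'm) cqp_monoid_scheme \<Rightarrow> ('a \<times> 'a) set \<Rightarrow> 'a set cqp_monoid"
  where "cqp_quotient M r =
    \<lparr>carrier = carrier M // r,
     mult = (\<lambda>X Y. \<Union>x\<in>X. \<Union>y\<in>Y. r `` {x \<otimes>\<^bsub>M\<^esub> y}),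
     one = r `` {\<one>\<^bsub>M\<^esub>},
     pairing = (\<lambda>X Y. \<Union>x\<in>X. \<Union>y\<in>Y. r `` {pairing M x y}),
     proj1 = r `` {proj1 M},
     proj2 = r `` {proj2 M}\<rparr>"

lemma cqp_quotient_mult:
  assumes "cqp_congruence M r" "a \<in> carrier M" "b \<in> carrier M"
  shows "r `` {a} \<otimes>\<^bsub>cqp_quotient M r\<^esub> r `` {b} = r `` {a \<otimes>\<^bsub>M\<^esub> b}"
proof -
  have e: "equiv (carrier M) r" and "congruent2 r r (\<lambda>x y. r `` {x \<otimes>\<^bsub>M\<^esub> y})"
    using assms(1) unfolding cqp_congruence_def congruent2_def
    by (auto intro!: equiv_class_eq)
  from UN_equiv_class2[OF e e this(2) assms(2,3)]
  show ?thesis by (simp add: cqp_quotient_def)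
qed

lemma cqp_quotient_pairing:
  assumes "cqp_congruence M r" "a \<in> carrier M" "b \<in> carrier M"
  shows "pairing (cqp_quotient M r) (r `` {a}) (r `` {b}) = r `` {pairing M a b}"
proof -
  have e: "equiv (carrier M) r" and "congruent2 r r (\<lambda>x y. r `` {pairing M x y})"
    using assms(1) unfolding cqp_congruence_def congruent2_def
    by (auto intro!: equiv_class_eq)
  from UN_equiv_class2[OF e e this(2) assms(2,3)]
  show ?thesis by (simp add: cqp_quotient_def)
qed

text \<open>The free monoid \<open>F\<close> on two symbols is \<open>letter list\<close> under concatenation.\<close>

datatype letter = L1 | L2

datatype tree = Leaf "letter list" | Node tree tree

fun act_letter :: "letter \<Rightarrow> tree \<Rightarrow> tree" where
  "act_letter s (Leaf w) = Leaf (s # w)"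
| "act_letter L1 (Node A B) = A"
| "act_letter L2 (Node A B) = B"

definition act :: "letter list \<Rightarrow> tree \<Rightarrow> tree"
  where "act w A = foldr act_letter w A"

fun tree_mult :: "tree \<Rightarrow> tree \<Rightarrow> tree" where
  "tree_mult (Leaf w) B = act w B"
| "tree_mult (Node A1 A2) B = Node (tree_mult A1 B) (tree_mult A2 B)"

definition T :: "tree cqp_monoid"
  where "T = \<lparr>carrier = UNIV, mult = tree_mult, one = Leaf [],
    pairing = Node, proj1 = Leaf [L1], proj2 = Leaf [L2]\<rparr>"

lemma tree_mult_act_letter: "tree_mult (act_letter s A) B = act_letter s (tree_mult A B)"
  by (cases A; cases s) (simp_all add: act_def)

lemma tree_mult_act: "tree_mult (act w A) B = act w (tree_mult A B)"
  by (induction w) (simp_all add: act_def tree_mult_act_letter)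

lemma tree_mult_assoc: "tree_mult (tree_mult A B) C = tree_mult A (tree_mult B C)"
  by (induction A) (simp_all add: tree_mult_act)

lemma act_Leaf: "act w (Leaf v) = Leaf (w @ v)"
  by (induction w) (simp_all add: act_def)

lemma tree_mult_one_right: "tree_mult A (Leaf []) = A"
  by (induction A) (simp_all add: act_Leaf)

lemma cqp_monoid_T: "cqp_monoid T"
  by unfold_locales
    (simp_all add: T_def tree_mult_assoc tree_mult_one_right, simp_all add: act_def)

definition cp_congruence :: "(tree \<times> tree) set"
  where "cp_congruence =
    \<Inter>{r. cqp_congruence T r \<and> (pairing T (proj1 T) (proj2 T), \<one>\<^bsub>T\<^esub>) \<in> r}"

lemma cp_congruence_congruence: "cqp_congruence T cp_congruence"
  unfolding cqp_congruence_def
proof (intro conjI)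
  show "equiv (carrier T) cp_congruence"
  proof (rule equivI)
    show "cp_congruence \<subseteq> carrier T \<times> carrier T" by (simp add: T_def)
    show "refl_on (carrier T) cp_congruence"
      unfolding cp_congruence_def cqp_congruence_def by (auto simp: refl_on_def equiv_def)
    show "sym cp_congruence"
      unfolding cp_congruence_def cqp_congruence_def by (auto simp: sym_def equiv_def)
    show "trans cp_congruence"
      unfolding cp_congruence_def cqp_congruence_def equiv_def
      by (intro transI) (auto dest: transD)
  qed
next
  show "\<forall>a b c d. (a, b) \<in> cp_congruence \<longrightarrow> (c, d) \<in> cp_congruence \<longrightarrow>
      (a \<otimes>\<^bsub>T\<^esub> c, b \<otimes>\<^bsub>T\<^esub> d) \<in> cp_congruence \<and>
      (pairing T a c, pairing T b d) \<in> cp_congruence"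
    unfolding cp_congruence_def cqp_congruence_def by auto
qed

lemma cp_congruence_base: "(pairing T (proj1 T) (proj2 T), \<one>\<^bsub>T\<^esub>) \<in> cp_congruence"
  unfolding cp_congruence_def by blast

lemma cp_congruence_least:
  assumes "cqp_congruence T r" "(pairing T (proj1 T) (proj2 T), \<one>\<^bsub>T\<^esub>) \<in> r"
  shows "cp_congruence \<subseteq> r"
  using assms unfolding cp_congruence_def by blast

definition U :: "tree set cqp_monoid"
  where "U = cqp_quotient T cp_congruence"

end

theory Submission imports Defs
begin

text \<open>
  In a CP monoid every \<open>x\<close> equals \<open>\<Sigma>(\<pi>\<^sub>1 x, \<pi>\<^sub>2 x)\<close>, because \<open>\<Sigma>\<close> is onto. Hence CP monoids are exactly
  the CQP monoids with \<open>\<Sigma>(\<pi>\<^sub>1, \<pi>\<^sub>2) = 1\<close>, an equational class in which the quotient of \<open>T\<close> by the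
  congruence generated by that equation is the initial object: a tree has only one possible value in
  a CP monoid \<open>N\<close> (\<open>tree_val\<close>), and evaluation is a homomorphism whose kernel is a congruence
  identifying \<open>\<Sigma>(\<pi>\<^sub>1, \<pi>\<^sub>2)\<close> with \<open>1\<close>.

  Injectivity says that trees with the same value in a non-zero CP monoid are congruent. In \<open>U\<close> a
  leaf \<open>w\<close> may be expanded to \<open>\<Sigma>(\<pi>\<^sub>1 w, \<pi>\<^sub>2 w)\<close>. Expanding leaves until two given trees have the same
  shape and cancelling \<open>\<Sigma>\<close> on values, one is left with comparing leaf colors, so all that is
  needed is that different words in \<open>\<pi>\<^sub>1, \<pi>\<^sub>2\<close> have different values (\<open>word_val_inj\<close>). For this, read
  words from their last letter: multiplying on the right by \<open>\<Sigma>(a, b)\<close> replaces a last letter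
  \<open>\<pi>\<^sub>1\<close> by \<open>a\<close> and a last letter \<open>\<pi>\<^sub>2\<close> by \<open>b\<close>. If two words of equal value differ, after removing a
  common suffix this substitution yields an equation in which \<open>a\<close> and \<open>b\<close> vary independently, and
  that collapses the monoid.
\<close>

section \<open>CP monoids as an equational class\<close>

context cp_monoid
begin

lemma pairing_closed [simp, intro]:
  "\<lbrakk>a \<in> carrier M; b \<in> carrier M\<rbrakk> \<Longrightarrow> pairing M a b \<in> carrier M"
  using pairing_bij by (auto simp: bij_betw_def)

lemma pairing_projs:
  assumes "x \<in> carrier M"
  shows "pairing M (proj1 M \<otimes> x) (proj2 M \<otimes> x) = x"
proof -
  have "x \<in> (\<lambda>(a, b). pairing M a b) ` (carrier M \<times> carrier M)"
    using assms bij_betw_imp_surj_on [OF pairing_bij] by simp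
  then obtain a b where "a \<in> carrier M" "b \<in> carrier M" "x = pairing M a b"
    by auto
  then show ?thesis by (simp add: proj1_pairing proj2_pairing)
qed

text \<open>Both sides have the same projections.\<close>

lemma pairing_mult:
  assumes "a \<in> carrier M" "b \<in> carrier M" "c \<in> carrier M"
  shows "pairing M a b \<otimes> c = pairing M (a \<otimes> c) (b \<otimes> c)"
proof -
  have "proj1 M \<otimes> (pairing M a b \<otimes> c) = a \<otimes> c"
    and "proj2 M \<otimes> (pairing M a b \<otimes> c) = b \<otimes> c"
    using assms by (simp_all add: m_assoc [symmetric] proj1_pairing proj2_pairing)
  moreover have "pairing M (proj1 M \<otimes> (pairing M a b \<otimes> c)) (proj2 M \<otimes> (pairing M a b \<otimes> c))
      = pairing M a b \<otimes> c"
    using assms by (intro pairing_projs) simp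
  ultimately show ?thesis by metis
qed

lemma pairing_inject:
  assumes "pairing M a b = pairing M c d"
    and "a \<in> carrier M" "b \<in> carrier M" "c \<in> carrier M" "d \<in> carrier M"
  shows "a = c \<and> b = d"
  using assms proj1_pairing [of a b] proj1_pairing [of c d]
    proj2_pairing [of a b] proj2_pairing [of c d] by simp

end

lemma cp_monoid_if_pairing_projs_eq_one:
  assumes "cqp_monoid M" and "pairing M (proj1 M) (proj2 M) = \<one>\<^bsub>M\<^esub>"
  shows "cp_monoid M"
proof -
  interpret cqp_monoid M by fact
  show ?thesis
  proof
    have "pairing M (proj1 M \<otimes>\<^bsub>M\<^esub> x) (proj2 M \<otimes>\<^bsub>M\<^esub> x) = x" if "x \<in> carrier M" for x
      using that assms(2) by (simp add: pairing_mult)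
    then show "bij_betw (\<lambda>(a, b). pairing M a b) (carrier M \<times> carrier M) (carrier M)"
      by (intro bij_betw_byWitness [where f' = "\<lambda>x. (proj1 M \<otimes>\<^bsub>M\<^esub> x, proj2 M \<otimes>\<^bsub>M\<^esub> x)"])
        (auto simp: proj1_pairing proj2_pairing)
  qed (simp_all add: proj1_pairing proj2_pairing)
qed

section \<open>Values of words and trees\<close>

primrec letter_val :: "('a, 'm) cqp_monoid_scheme \<Rightarrow> letter \<Rightarrow> 'a" where
  "letter_val M L1 = proj1 M"
| "letter_val M L2 = proj2 M"

primrec word_val :: "('a, 'm) cqp_monoid_scheme \<Rightarrow> letter list \<Rightarrow> 'a" where
  "word_val M [] = \<one>\<^bsub>M\<^esub>"
| "word_val M (s # w) = letter_val M s \<otimes>\<^bsub>M\<^esub> word_val M w"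

primrec tree_val :: "('a, 'm) cqp_monoid_scheme \<Rightarrow> tree \<Rightarrow> 'a" where
  "tree_val M (Leaf w) = word_val M w"
| "tree_val M (Node A B) = pairing M (tree_val M A) (tree_val M B)"

context cp_monoid
begin

lemma letter_val_closed [simp, intro]: "letter_val M s \<in> carrier M"
  by (cases s) auto

lemma word_val_closed [simp, intro]: "word_val M w \<in> carrier M"
  by (induction w) auto

lemma tree_val_closed [simp, intro]: "tree_val M A \<in> carrier M"
  by (induction A) auto

lemma letter_val_pairing:
  assumes "a \<in> carrier M" "b \<in> carrier M"
  shows "letter_val M s \<otimes> pairing M a b = (case s of L1 \<Rightarrow> a | L2 \<Rightarrow> b)"
  using assms by (cases s) (simp_all add: proj1_pairing proj2_pairing)

lemma word_val_snoc: "word_val M (w @ [s]) = word_val M w \<otimes> letter_val M s"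
  by (induction w) (simp_all add: m_assoc)

lemma word_val_snoc_pairing:
  assumes "a \<in> carrier M" "b \<in> carrier M"
  shows "word_val M (w @ [s]) \<otimes> pairing M a b = word_val M w \<otimes> (case s of L1 \<Rightarrow> a | L2 \<Rightarrow> b)"
  using assms by (simp add: word_val_snoc m_assoc letter_val_pairing)

lemma tree_val_act_letter: "tree_val M (act_letter s A) = letter_val M s \<otimes> tree_val M A"
  by (cases A; cases s) (simp_all add: proj1_pairing proj2_pairing)

lemma tree_val_act: "tree_val M (act w A) = word_val M w \<otimes> tree_val M A"
  by (induction w) (simp_all add: act_def tree_val_act_letter m_assoc)

lemma tree_val_mult: "tree_val M (tree_mult A B) = tree_val M A \<otimes> tree_val M B"
  by (induction A) (simp_all add: tree_val_act pairing_mult)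

text \<open>The kernel of evaluation is a congruence containing the pair \<open>(\<Sigma>(\<pi>\<^sub>1, \<pi>\<^sub>2), 1)\<close>, so it contains the
  smallest one; this makes evaluation well defined on \<open>U\<close>.\<close>

lemma tree_val_cong:
  assumes "(A, B) \<in> cp_congruence"
  shows "tree_val M A = tree_val M B"
proof -
  have "cp_congruence \<subseteq> {(A, B). tree_val M A = tree_val M B}"
  proof (rule cp_congruence_least)
    show "cqp_congruence T {(A, B). tree_val M A = tree_val M B}"
      unfolding cqp_congruence_def
      by (auto simp: T_def tree_val_mult equiv_def refl_on_def sym_def trans_def)
    show "(pairing T (proj1 T) (proj2 T), \<one>\<^bsub>T\<^esub>) \<in> {(A, B). tree_val M A = tree_val M B}"
      using pairing_projs [of \<one>] by (simp add: T_def)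
  qed
  with assms show ?thesis by blast
qed

end

section \<open>The quotient of the tree monoid\<close>

lemma equiv_cp_congruence: "equiv UNIV cp_congruence"
  using cp_congruence_congruence by (simp add: cqp_congruence_def T_def)

lemma cp_congruence_refl: "(A, A) \<in> cp_congruence"
  using equiv_cp_congruence by (simp add: equiv_def refl_on_def)

lemma cp_congruence_trans:
  "\<lbrakk>(A, B) \<in> cp_congruence; (B, C) \<in> cp_congruence\<rbrakk> \<Longrightarrow> (A, C) \<in> cp_congruence"
  using equiv_cp_congruence by (meson equivE transD)

lemma cp_congruence_sym: "(A, B) \<in> cp_congruence \<Longrightarrow> (B, A) \<in> cp_congruence"
  using equiv_cp_congruence by (meson equivE symD)

lemma cp_congruence_Node:
  "\<lbrakk>(A, B) \<in> cp_congruence; (C, D) \<in> cp_congruence\<rbrakk> \<Longrightarrow> (Node A C, Node B D) \<in> cp_congruence"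
  using cp_congruence_congruence by (simp add: cqp_congruence_def T_def)

lemma cp_congruence_mult:
  "\<lbrakk>(A, B) \<in> cp_congruence; (C, D) \<in> cp_congruence\<rbrakk>
    \<Longrightarrow> (tree_mult A C, tree_mult B D) \<in> cp_congruence"
  using cp_congruence_congruence by (simp add: cqp_congruence_def T_def)

text \<open>This is the relation \<open>\<Sigma>(\<pi>\<^sub>1, \<pi>\<^sub>2) \<sim> 1\<close> multiplied on the right by \<open>w\<close>.\<close>

lemma cp_congruence_expand_leaf:
  "(Node (Leaf (L1 # w)) (Leaf (L2 # w)), Leaf w) \<in> cp_congruence"
proof -
  have "(Node (Leaf [L1]) (Leaf [L2]), Leaf []) \<in> cp_congruence"
    using cp_congruence_base by (simp add: T_def)
  from cp_congruence_mult [OF this cp_congruence_refl [of "Leaf w"]]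
  show ?thesis by (simp add: act_def)
qed

definition tree_class :: "tree \<Rightarrow> tree set"
  where "tree_class A = cp_congruence `` {A}"

lemma tree_class_eq_iff: "tree_class A = tree_class B \<longleftrightarrow> (A, B) \<in> cp_congruence"
  by (simp add: tree_class_def eq_equiv_class_iff [OF equiv_cp_congruence])

lemma carrier_U: "carrier U = range tree_class"
  by (simp add: U_def cqp_quotient_def T_def quotient_def tree_class_def
      UNION_singleton_eq_range)

lemma tree_class_in_carrier_U [simp]: "tree_class A \<in> carrier U"
  by (simp add: carrier_U)

lemma mult_U: "tree_class A \<otimes>\<^bsub>U\<^esub> tree_class B = tree_class (tree_mult A B)"
  using cqp_quotient_mult [OF cp_congruence_congruence] by (simp add: U_def T_def tree_class_def)

lemma pairing_U: "pairing U (tree_class A) (tree_class B) = tree_class (Node A B)"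
  using cqp_quotient_pairing [OF cp_congruence_congruence] by (simp add: U_def T_def tree_class_def)

lemma one_U: "\<one>\<^bsub>U\<^esub> = tree_class (Leaf [])"
  and proj1_U: "proj1 U = tree_class (Leaf [L1])"
  and proj2_U: "proj2 U = tree_class (Leaf [L2])"
  by (simp_all add: U_def cqp_quotient_def T_def tree_class_def)

lemmas U_simps = carrier_U mult_U pairing_U one_U proj1_U proj2_U

lemma cp_monoid_U: "cp_monoid U"
proof (rule cp_monoid_if_pairing_projs_eq_one)
  show "cqp_monoid U"
    by unfold_locales
      (auto simp: U_simps tree_mult_assoc tree_mult_one_right act_def)
  show "pairing U (proj1 U) (proj2 U) = \<one>\<^bsub>U\<^esub>"
    unfolding U_simps tree_class_eq_iff by (rule cp_congruence_expand_leaf)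
qed

section \<open>Initiality\<close>

lemma tree_class_Leaf_Cons:
  "tree_class (Leaf (s # w)) = letter_val U s \<otimes>\<^bsub>U\<^esub> tree_class (Leaf w)"
  by (cases s) (simp_all add: U_simps act_def)

text \<open>Multiplication and \<open>\<Sigma>\<close> generate all of \<open>U\<close> from \<open>1, \<pi>\<^sub>1, \<pi>\<^sub>2\<close>, so a homomorphism has no
  choice.\<close>

lemma cqp_hom_U_tree_class:
  assumes "\<phi> \<in> cqp_hom U N"
  shows "\<phi> (tree_class A) = tree_val N A"
proof (induction A)
  case (Leaf w)
  have letter: "\<phi> (letter_val U s) = letter_val N s" and in_U: "letter_val U s \<in> carrier U" for s
    using assms by (cases s; simp add: cqp_hom_def U_simps)+
  show ?case
  proof (induction w)
    case Nil
    show ?case using assms by (simp add: cqp_hom_def one_U)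
  next
    case (Cons s w)
    have "\<phi> (tree_class (Leaf (s # w))) = \<phi> (letter_val U s) \<otimes>\<^bsub>N\<^esub> \<phi> (tree_class (Leaf w))"
      using assms in_U unfolding tree_class_Leaf_Cons
      by (simp add: cqp_hom_def hom_def)
    with Cons letter show ?case by simp
  qed
next
  case (Node A B)
  have "\<phi> (tree_class (Node A B)) = pairing N (\<phi> (tree_class A)) (\<phi> (tree_class B))"
    using assms by (simp add: cqp_hom_def flip: pairing_U)
  with Node show ?case by simp
qed

lemma (in cp_monoid) ex_cqp_hom_U:
  "\<exists>\<phi>. \<phi> \<in> extensional (carrier U) \<and> \<phi> \<in> cqp_hom U M"
proof -
  define \<phi> where "\<phi> = restrict (\<lambda>X. tree_val M (SOME A. A \<in> X)) (carrier U)"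
  have \<phi>: "\<phi> (tree_class A) = tree_val M A" for A
  proof -
    have "(SOME B. B \<in> tree_class A) \<in> tree_class A"
      by (rule someI [of _ A]) (simp add: tree_class_def cp_congruence_refl)
    then have "tree_val M A = tree_val M (SOME B. B \<in> tree_class A)"
      by (simp add: tree_class_def tree_val_cong)
    then show ?thesis by (simp add: \<phi>_def carrier_U)
  qed
  have "\<phi> \<in> extensional (carrier U)" by (simp add: \<phi>_def)
  moreover have "\<phi> \<in> cqp_hom U M"
    by (auto simp: cqp_hom_def hom_def U_simps \<phi> tree_val_mult)
  ultimately show ?thesis by blast
qed

lemma (in cp_monoid) ex1_cqp_hom_U:
  "\<exists>!\<phi>. \<phi> \<in> extensional (carrier U) \<and> \<phi> \<in> cqp_hom U M"
proof (rule ex_ex1I)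
  show "\<exists>\<phi>. \<phi> \<in> extensional (carrier U) \<and> \<phi> \<in> cqp_hom U M"
    by (rule ex_cqp_hom_U)
next
  fix \<phi> \<psi>
  assume "\<phi> \<in> extensional (carrier U) \<and> \<phi> \<in> cqp_hom U M"
    and "\<psi> \<in> extensional (carrier U) \<and> \<psi> \<in> cqp_hom U M"
  then show "\<phi> = \<psi>"
    by (intro extensionalityI [of \<phi> "carrier U"]) (auto simp: carrier_U cqp_hom_U_tree_class)
qed

section \<open>Injectivity\<close>

context cp_monoid
begin

text \<open>Each letter has the right inverse \<open>\<Sigma>(1, 1)\<close>.\<close>

lemma word_val_right_inverse: "\<exists>r \<in> carrier M. word_val M w \<otimes> r = \<one>"
proof (induction w rule: rev_induct)
  case Nil
  show ?case by auto
next
  case (snoc s w)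
  then obtain r where r: "r \<in> carrier M" "word_val M w \<otimes> r = \<one>" by blast
  have "word_val M (w @ [s]) \<otimes> pairing M r r = \<one>"
    using r by (simp add: word_val_snoc_pairing split: letter.split)
  with r show ?case by blast
qed

text \<open>From \<open>u \<pi>\<^sub>s = 1\<close> one gets \<open>u c\<^sub>s = \<Sigma>(c\<^sub>1, c\<^sub>2)\<close> for all \<open>c\<^sub>1, c\<^sub>2\<close>. The left side ignores one of
  the two components and the right side determines both.\<close>

lemma word_val_snoc_neq_one:
  assumes "nonzero_monoid M"
  shows "word_val M (w @ [s]) \<noteq> \<one>"
proof
  assume one: "word_val M (w @ [s]) = \<one>"
  from assms obtain x y where xy: "x \<in> carrier M" "y \<in> carrier M" "x \<noteq> y"
    by (auto simp: nonzero_monoid_def)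
  have eq: "word_val M w \<otimes> (case s of L1 \<Rightarrow> a | L2 \<Rightarrow> b) = pairing M a b"
    if "a \<in> carrier M" "b \<in> carrier M" for a b
    using word_val_snoc_pairing [OF that, of w s] one that by simp
  show False
  proof (cases s)
    case L1
    with eq [of x x] eq [of x y] xy have "pairing M x x = pairing M x y" by simp
    with xy show False using pairing_inject by blast
  next
    case L2
    with eq [of x x] eq [of y x] xy have "pairing M x x = pairing M y x" by simp
    with xy show False using pairing_inject by blast
  qed
qed

text \<open>From \<open>u \<pi>\<^sub>1 = v \<pi>\<^sub>2\<close> one gets \<open>u a = v b\<close> for all \<open>a, b\<close>. Letting \<open>a\<close> run over the right
  multiples of a right inverse of \<open>u\<close> makes the left side arbitrary, while the right side is
  constant.\<close>

lemma word_val_last_letter_neq: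
  assumes "nonzero_monoid M"
  shows "word_val M (u @ [L1]) \<noteq> word_val M (v @ [L2])"
proof
  assume eq: "word_val M (u @ [L1]) = word_val M (v @ [L2])"
  from assms obtain x y where xy: "x \<in> carrier M" "y \<in> carrier M" "x \<noteq> y"
    by (auto simp: nonzero_monoid_def)
  obtain r where r: "r \<in> carrier M" "word_val M u \<otimes> r = \<one>"
    using word_val_right_inverse by blast
  have "z = word_val M v" if z: "z \<in> carrier M" for z
  proof -
    have "z = word_val M u \<otimes> (r \<otimes> z)"
      using r z by (simp flip: m_assoc)
    also have "\<dots> = word_val M (u @ [L1]) \<otimes> pairing M (r \<otimes> z) \<one>"
      using r z by (simp add: word_val_snoc_pairing)
    also have "\<dots> = word_val M v"
      using r z by (simp add: eq word_val_snoc_pairing)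
    finally show ?thesis .
  qed
  with xy show False by metis
qed

lemma word_val_inj:
  assumes "nonzero_monoid M" and "word_val M w = word_val M v"
  shows "w = v"
  using assms(2)
proof (induction w arbitrary: v rule: rev_induct)
  case Nil
  then show ?case
    using word_val_snoc_neq_one [OF assms(1)] by (cases v rule: rev_cases) force+
next
  case (snoc s w)
  show ?case
  proof (cases v rule: rev_cases)
    case Nil
    with snoc.prems show ?thesis using word_val_snoc_neq_one [OF assms(1)] by force
  next
    case v: (snoc v' t)
    have st: "s = t"
      using word_val_last_letter_neq [OF assms(1)] snoc.prems v
      by (cases s; cases t) (simp, metis, metis, simp)
    have "word_val M w = word_val M (w @ [s]) \<otimes> pairing M \<one> \<one>"
      by (simp add: word_val_snoc_pairing split: letter.split)
    also have "\<dots> = word_val M v'"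
      using snoc.prems by (simp add: v word_val_snoc_pairing split: letter.split)
    finally show ?thesis using snoc.IH st v by simp
  qed
qed

text \<open>Comparing a leaf with an inner node expands the leaf once; the recursion then continues on
  the subtrees of the node, so structural induction suffices although the words get longer.\<close>

lemma cp_congruence_if_tree_val_Leaf_eq:
  assumes "nonzero_monoid M" and "word_val M w = tree_val M B"
  shows "(Leaf w, B) \<in> cp_congruence"
  using assms(2)
proof (induction B arbitrary: w)
  case (Leaf v)
  then have "w = v" using word_val_inj [OF assms(1)] by simp
  then show ?case by (simp add: cp_congruence_refl)
next
  case (Node B1 B2)
  have "word_val M (L1 # w) = tree_val M B1" "word_val M (L2 # w) = tree_val M B2"
    using Node.prems by (simp_all add: proj1_pairing proj2_pairing)
  then have "(Node (Leaf (L1 # w)) (Leaf (L2 # w)), Node B1 B2) \<in> cp_congruence"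
    by (intro cp_congruence_Node Node.IH)
  then show ?case
    by (rule cp_congruence_trans [OF cp_congruence_sym [OF cp_congruence_expand_leaf]])
qed

lemma cp_congruence_if_tree_val_eq:
  assumes "nonzero_monoid M" and "tree_val M A = tree_val M B"
  shows "(A, B) \<in> cp_congruence"
  using assms(2)
proof (induction A arbitrary: B)
  case (Leaf w)
  then show ?case using cp_congruence_if_tree_val_Leaf_eq [OF assms(1)] by simp
next
  case (Node A1 A2)
  show ?case
  proof (cases B)
    case (Leaf w)
    with Node.prems have "word_val M w = tree_val M (Node A1 A2)" by simp
    then have "(Leaf w, Node A1 A2) \<in> cp_congruence"
      by (rule cp_congruence_if_tree_val_Leaf_eq [OF assms(1)])
    then show ?thesis unfolding Leaf by (rule cp_congruence_sym)
  next
    case B: (Node B1 B2)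
    have "tree_val M A1 = tree_val M B1 \<and> tree_val M A2 = tree_val M B2"
      using Node.prems by (intro pairing_inject) (simp_all add: B)
    then have "(Node A1 A2, Node B1 B2) \<in> cp_congruence"
      by (simp add: cp_congruence_Node Node.IH)
    then show ?thesis by (simp add: B)
  qed
qed

lemma cqp_hom_U_inj_on:
  assumes "nonzero_monoid M" and "\<phi> \<in> cqp_hom U M"
  shows "inj_on \<phi> (carrier U)"
proof (rule inj_onI)
  fix X Y
  assume "X \<in> carrier U" "Y \<in> carrier U" and eq: "\<phi> X = \<phi> Y"
  then obtain A B where AB: "X = tree_class A" "Y = tree_class B"
    by (auto simp: carrier_U)
  with eq have "tree_val M A = tree_val M B"
    by (simp add: cqp_hom_U_tree_class [OF assms(2)])
  then show "X = Y"
    unfolding AB tree_class_eq_iff by (rule cp_congruence_if_tree_val_eq [OF assms(1)])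
qed

end

theorem theorem2:
  "cp_monoid U \<and>
   (\<forall>N :: ('b, 'n) cqp_monoid_scheme. cp_monoid N \<longrightarrow>
      (\<exists>!\<phi>. \<phi> \<in> extensional (carrier U) \<and> \<phi> \<in> cqp_hom U N)) \<and>
   (\<forall>N :: ('b, 'n) cqp_monoid_scheme. cp_monoid N \<and> nonzero_monoid N \<longrightarrow>
      (\<forall>\<phi> \<in> cqp_hom U N. inj_on \<phi> (carrier U)))"
  using cp_monoid_U cp_monoid.ex1_cqp_hom_U cp_monoid.cqp_hom_U_inj_on by blast

end
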